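(* For every totally positive $A\in\mathcal{SS}_n^{>0}$ and every subset $I\subseteq[n]$ of even size, \[ \operatorname{sgn}(\mathrm{Pf}_I(A))=(-1)^{\sum_{i\in I}i-\binom{|I|+1}{2}}=:\operatorname{sgn}(I,[n]); \] in particular $\mathrm{Pf}_I(A)\neq0$. Equivalently, if $I=\{i_1<\cdots<i_{|I|}\}$ and $[n]\setminus I=\{j_1<\cdots<j_{n-|I|}\}$, this is the sign of the permutation $i_1,\dots,i_{|I|},j_1,\dots,j_{n-|I|}$ in one-line notation.
   Context: For a skew-symmetric $2m\times 2m$ matrix $B=(b_{ij})$, $\mathrm{Pf}(B)=\frac{1}{2^m m!}\sum_{\sigma\in S_{2m}}\operatorname{sgn}(\sigma)\prod_{i=1}^m b_{\sigma(2i-1),\sigma(2i)}$. For $A\in\mathcal{SS}_n$ and $I\subseteq[n]$ of even size, $\mathrm{Pf}_I(A)$ is the Pfaffian of the principal submatrix of $A$ with rows and columns $I$ (in increasing order), with $\mathrm{Pf}_\emptyset(A)=1$. Totally positive matrices: fix $n\ge2$, $N=\binom n2$; let $x_i(t)=\mathrm{Id}_{2n}+tE_{i,i+1}-tE_{n+i+1,n+i}$ ($1\le i\le n-1$), $x_n(t)=\mathrm{Id}_{2n}+tE_{n-1,2n}-tE_{n,2n-1}$ ($E_{a,b}$ matrix units); let $(i_1,\dots,i_N)$ be the concatenation, for $m=1,\dots,\lfloor n/2\rfloor$, of the blocks "$n$", "$n-2,n-3,\dots,2m-1$", "$n-1,n-2,\dots,2m$" (empty runs if start $<$ end). For $t\in\mathbb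 R^N$ let $[U(t)\mid R(t)]$ be the first $n$ rows of $x_{i_1}(t_1)\cdots x_{i_N}(t_N)$ ($U(t)$ the upper unitriangular left block) and $A(t)=U(t)^{-1}R(t)$. Then $\mathcal{SS}_n^{>0}=\{A(t):t\in\mathbb R^N_{>0}\}$. *)

theory Defs
  imports "Jordan_Normal_Form.Determinant" "Jordan_Normal_Form.DL_Submatrix"
begin

text \<open>Matrices are JNF matrices with 0-based indices; paper index k corresponds to k-1.\<close>

definition pfaffian :: "real mat \<Rightarrow> real" where
  "pfaffian B = (let m = dim_row B div 2 in
     (1 / (2 ^ m * fact m)) *
     (\<Sum>\<sigma> | \<sigma> permutes {0..<2*m}. signof \<sigma> * (\<Prod>i<m. B $$ (\<sigma> (2*i), \<sigma> (2*i+1)))))"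

text \<open>Principal Pfaffian Pf_I(A) for I a subset of [n] = {1..n} (1-based), rows/columns in increasing order.\<close>
definition pf_sub :: "real mat \<Rightarrow> nat set \<Rightarrow> real" where
  "pf_sub A I = pfaffian (submatrix A ((\<lambda>i. i - 1) ` I) ((\<lambda>i. i - 1) ` I))"

definition xgen :: "nat \<Rightarrow> nat \<Rightarrow> real \<Rightarrow> real mat" where
  "xgen n i t = mat (2*n) (2*n) (\<lambda>(r,c).
     (if r = c then 1 else 0) +
     (if i < n then
        (if (r,c) = (i-1, i) then t else 0) - (if (r,c) = (n+i, n+i-1) then t else 0)
      else
        (if (r,c) = (n-2, 2*n-1) then t else 0) - (if (r,c) = (n-1, 2*n-2) then t else 0)))"

definition tp_word :: "nat \<Rightarrow> nat list" where
  "tp_word n = concat (map (\<lambda>m. [n] @ rev [2*m-1..<n-1] @ rev [2*m..<n]) [1..<n div 2 + 1])"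

text \<open>x_{i_1}(t_1) ... x_{i_N}(t_N); parameter t_k (1-based) is t (k-1).\<close>
definition tp_prod :: "nat \<Rightarrow> (nat \<Rightarrow> real) \<Rightarrow> real mat" where
  "tp_prod n t = foldr (\<lambda>k M. xgen n (tp_word n ! k) (t k) * M) [0..<length (tp_word n)] (1\<^sub>m (2*n))"

definition U_part :: "nat \<Rightarrow> (nat \<Rightarrow> real) \<Rightarrow> real mat" where
  "U_part n t = mat n n (\<lambda>(i,j). tp_prod n t $$ (i, j))"

definition R_part :: "nat \<Rightarrow> (nat \<Rightarrow> real) \<Rightarrow> real mat" where
  "R_part n t = mat n n (\<lambda>(i,j). tp_prod n t $$ (i, n + j))"

definition mat_inv :: "nat \<Rightarrow> real mat \<Rightarrow> real mat" where
  "mat_inv n U = (SOME B. B \<in> carrier_mat n n \<and> U * B = 1\<^sub>m n \<and> B * U = 1\<^sub>m n)"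

definition A_of :: "nat \<Rightarrow> (nat \<Rightarrow> real) \<Rightarrow> real mat" where
  "A_of n t = mat_inv n (U_part n t) * R_part n t"

definition SS_pos :: "nat \<Rightarrow> real mat set" where
  "SS_pos n = {A_of n t | t. \<forall>k < length (tp_word n). t k > 0}"

end

theory Submission
  imports Defs
begin

text \<open>Multiplying \<open>[U | U A]\<close> on the right by a generator changes \<open>A\<close> as follows: \<open>x\<^sub>i(t)\<close> with \<open>i < n\<close>
  replaces \<open>A\<close> by \<open>g A g\<^sup>T\<close> with \<open>g = 1 - t E\<^sub>i\<^sub>,\<^sub>i\<^sub>+\<^sub>1\<close>, and \<open>x\<^sub>n(t)\<close> adds \<open>t\<close> times the elementary
  skew-symmetric matrix in the last two indices. On principal Pfaffians, normalised by the claimed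
  sign, this reads \<open>q\<^sub>J := q\<^sub>J + t q\<^sub>K\<close> where \<open>J\<close> arises from \<open>K\<close> by moving a particle from \<open>i + 1\<close> to a
  free site \<open>i\<close>, respectively by inserting particles at the free sites \<open>n - 1\<close> and \<open>n\<close>. Hence the
  \<open>q\<^sub>J\<close> remain nonnegative, and \<open>q\<^sub>J\<close> is positive as soon as some subword of the word leads from the
  empty configuration to \<open>J\<close>. The \<open>m\<close>-th round of the word inserts two particles and slides them to
  the positions of the elements number \<open>2 m - 1\<close> and \<open>2 m\<close> of \<open>J\<close>, so every even \<open>J\<close> is reached.\<close>

section \<open>Pfaffian sums\<close>

text \<open>The entries come from an arbitrary function of two indices, so that relabelling the
  indices or replacing one row and column gives again a sum of this form.\<close>

definition pf_fun :: "(nat \<Rightarrow> nat \<Rightarrow> real) \<Rightarrow> nat \<Rightarrow> real" where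
  "pf_fun F m = (1 / (2 ^ m * fact m)) *
     (\<Sum>\<sigma> | \<sigma> permutes {0..<2*m}. signof \<sigma> * (\<Prod>i<m. F (\<sigma> (2*i)) (\<sigma> (2*i+1))))"

lemma permutes_neq_lt:
  fixes \<sigma> :: "nat \<Rightarrow> nat"
  assumes "\<sigma> permutes {0..<2*m}" "i < m"
  shows "\<sigma> (2*i) < 2*m" "\<sigma> (2*i+1) < 2*m" "\<sigma> (2*i) \<noteq> \<sigma> (2*i+1)"
proof -
  show "\<sigma> (2*i) < 2*m" "\<sigma> (2*i+1) < 2*m"
    using permutes_in_image[OF assms(1), of "2*i"] permutes_in_image[OF assms(1), of "2*i+1"] assms(2)
    by auto
  show "\<sigma> (2*i) \<noteq> \<sigma> (2*i+1)"
    using inj_eq[OF permutes_inj[OF assms(1)], of "2*i" "2*i+1"] by simp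
qed

text \<open>Only off-diagonal entries occur, because a permutation sends the two positions of a pair
  to different indices.\<close>

lemma pf_fun_cong:
  assumes "\<And>a b. a < 2*m \<Longrightarrow> b < 2*m \<Longrightarrow> a \<noteq> b \<Longrightarrow> F a b = G a b"
  shows "pf_fun F m = pf_fun G m"
proof -
  have "(\<Prod>i<m. F (\<sigma> (2*i)) (\<sigma> (2*i+1))) = (\<Prod>i<m. G (\<sigma> (2*i)) (\<sigma> (2*i+1)))"
    if "\<sigma> permutes {0..<2*m}" for \<sigma>
    by (rule prod.cong[OF refl], rule assms) (use permutes_neq_lt[OF that] in auto)
  thus ?thesis unfolding pf_fun_def by simp
qed

text \<open>Isolates the single factor of a permutation's product in which the index
  \<open>p\<close> occurs, as first or as second argument.\<close>

lemma permutes_pair_index: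
  fixes \<sigma> :: "nat \<Rightarrow> nat"
  assumes "\<sigma> permutes {0..<2*m}" "p < 2*m"
  obtains j where "j < m" "\<sigma> (2*j) = p \<or> \<sigma> (2*j+1) = p"
    "\<And>i. i \<noteq> j \<Longrightarrow> \<sigma> (2*i) \<noteq> p \<and> \<sigma> (2*i+1) \<noteq> p"
proof -
  define s where "s = Hilbert_Choice.inv \<sigma> p"
  have s: "\<sigma> s = p" unfolding s_def using permutes_inverses(1)[OF assms(1)] .
  have s_lt: "s < 2*m"
    using permutes_in_image[OF permutes_inv[OF assms(1)], of p] assms(2) unfolding s_def by simp
  have uniq: "x = s" if "\<sigma> x = p" for x
    using that s permutes_inj[OF assms(1)] by (auto dest: injD)
  have "s = 2 * (s div 2) \<or> s = 2 * (s div 2) + 1" by presburger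
  hence "\<sigma> (2*(s div 2)) = p \<or> \<sigma> (2*(s div 2)+1) = p" using s by metis
  moreover have "s div 2 < m" using s_lt by simp
  moreover have "\<sigma> (2*i) \<noteq> p \<and> \<sigma> (2*i+1) \<noteq> p" if "i \<noteq> s div 2" for i
    using uniq[of "2*i"] uniq[of "2*i+1"] that by auto
  ultimately show ?thesis using that by blast
qed

text \<open>In every product exactly one factor involves \<open>p\<close>, so the Pfaffian sum is
  linear in row and column \<open>p\<close> taken together.\<close>

lemma pf_fun_linear:
  assumes p: "p < 2*m"
    and off: "\<And>a b. a < 2*m \<Longrightarrow> b < 2*m \<Longrightarrow> a \<noteq> p \<Longrightarrow> b \<noteq> p \<Longrightarrow> F a b = G a b \<and> H a b = G a b"
    and row: "\<And>b. b < 2*m \<Longrightarrow> b \<noteq> p \<Longrightarrow> F p b = G p b + c * H p b"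
    and col: "\<And>a. a < 2*m \<Longrightarrow> a \<noteq> p \<Longrightarrow> F a p = G a p + c * H a p"
  shows "pf_fun F m = pf_fun G m + c * pf_fun H m"
proof -
  let ?P = "\<lambda>F \<sigma>. \<Prod>i<m. (F (\<sigma> (2*i)) (\<sigma> (2*i+1)) :: real)"
  have key: "?P F \<sigma> = ?P G \<sigma> + c * ?P H \<sigma>" if \<sigma>: "\<sigma> permutes {0..<2*m}" for \<sigma>
  proof -
    obtain j where j: "j < m" "\<sigma> (2*j) = p \<or> \<sigma> (2*j+1) = p"
      "\<And>i. i \<noteq> j \<Longrightarrow> \<sigma> (2*i) \<noteq> p \<and> \<sigma> (2*i+1) \<noteq> p"
      using permutes_pair_index[OF \<sigma> p] by blast
    let ?R = "\<lambda>F. \<Prod>i\<in>{..<m}-{j}. (F (\<sigma> (2*i)) (\<sigma> (2*i+1)) :: real)"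
    have split: "?P X \<sigma> = X (\<sigma> (2*j)) (\<sigma> (2*j+1)) * ?R X" for X
      using j(1) by (simp add: prod.remove)
    have R: "?R F = ?R G" "?R H = ?R G"
      using j(3) off permutes_neq_lt[OF \<sigma>] by (auto intro!: prod.cong)
    have "F (\<sigma> (2*j)) (\<sigma> (2*j+1)) = G (\<sigma> (2*j)) (\<sigma> (2*j+1)) + c * H (\<sigma> (2*j)) (\<sigma> (2*j+1))"
      using j(2) row col permutes_neq_lt[OF \<sigma> j(1)] by metis
    thus ?thesis unfolding split R by (simp add: algebra_simps)
  qed
  have "(\<Sum>\<sigma> | \<sigma> permutes {0..<2*m}. signof \<sigma> * ?P F \<sigma>) =
    (\<Sum>\<sigma> | \<sigma> permutes {0..<2*m}. signof \<sigma> * ?P G \<sigma> + c * (signof \<sigma> * ?P H \<sigma>))"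
    by (rule sum.cong[OF refl]) (simp only: key mem_Collect_eq distrib_left mult.left_commute)
  thus ?thesis unfolding pf_fun_def
    by (simp add: sum.distrib sum_distrib_left[symmetric] algebra_simps)
qed

lemma signof_transpose_compose:
  assumes "\<sigma> permutes {0..<n}" "p < n" "q < n" "p \<noteq> q"
  shows "signof (transpose p q \<circ> \<sigma>) = - (signof \<sigma> :: real)"
    and "signof (\<sigma> \<circ> transpose p q) = - (signof \<sigma> :: real)"
proof -
  have \<sigma>: "permutation \<sigma>" using assms(1) permutation_permutes by blast
  show "signof (transpose p q \<circ> \<sigma>) = - (signof \<sigma> :: real)"
    "signof (\<sigma> \<circ> transpose p q) = - (signof \<sigma> :: real)"
    using assms(4) by (simp_all add: sign_compose[OF _ \<sigma>] sign_compose[OF \<sigma>] permutation_swap_id sign_swap_id)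
qed

text \<open>Composing with \<open>transpose p q\<close> on the left preserves each product and flips
  its sign factor, so the sum equals its own negative. This is the repeated-index case.\<close>

lemma pf_fun_eq_0:
  assumes "p < 2*m" "q < 2*m" "p \<noteq> q"
    and "\<And>a b. F (transpose p q a) (transpose p q b) = F a b"
  shows "pf_fun F m = 0"
proof -
  let ?f = "\<lambda>\<sigma>. signof \<sigma> * (\<Prod>i<m. F (\<sigma> (2*i)) (\<sigma> (2*i+1)))"
  let ?S = "\<Sum>\<sigma> | \<sigma> permutes {0..<2*m}. ?f \<sigma>"
  have t: "transpose p q permutes {0..<2*m}"
    using assms by (intro permutes_swap_id) auto
  have "?S = (\<Sum>\<sigma> | \<sigma> permutes {0..<2*m}. ?f (transpose p q \<circ> \<sigma>))"
    by (rule setum_permutations_compose_left[OF t])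
  also have "\<dots> = (\<Sum>\<sigma> | \<sigma> permutes {0..<2*m}. - ?f \<sigma>)"
  proof (rule sum.cong[OF refl])
    fix \<sigma> assume "\<sigma> \<in> {\<sigma>. \<sigma> permutes {0..<2*m}}"
    hence "signof (transpose p q \<circ> \<sigma>) = - (signof \<sigma> :: real)"
      using assms(1-3) by (intro signof_transpose_compose(1)) auto
    thus "?f (transpose p q \<circ> \<sigma>) = - ?f \<sigma>" by (simp only: o_apply assms(4) mult_minus_left)
  qed
  also have "\<dots> = - ?S" by (simp add: sum_negf)
  finally have "?S = 0" by simp
  thus ?thesis unfolding pf_fun_def by simp
qed

text \<open>By symmetry of the sum every one of the \<open>Suc k\<close> pair positions, in both orientations,
  contributes equally; these \<open>2 * Suc k\<close> copies cancel against the normalising factor.\<close>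

lemma pf_fun_unit_last:
  assumes G: "\<And>a b. a < 2*k \<Longrightarrow> b < 2*k \<Longrightarrow> H a b = G a b"
    and H1: "H (2*k) (Suc (2*k)) = 1" "H (Suc (2*k)) (2*k) = -1"
    and H0: "\<And>a. a < 2*k \<Longrightarrow> H a (Suc (2*k)) = 0 \<and> H (Suc (2*k)) a = 0"
  shows "pf_fun H (Suc k) = pf_fun G k"
proof -
  let ?p = "Suc (2*k)"
  let ?S = "{\<sigma>. \<sigma> permutes {0..<2 * Suc k}}"
  \<comment> \<open>\<open>D\<close> keeps only the entries of \<open>H\<close> on the index pair
    formed by \<open>2*k\<close> and \<open>?p\<close>. Hence \<open>g j\<close> is the contribution
    of the permutations whose pair number \<open>j\<close> is this pair.\<close>
  define D :: "nat \<Rightarrow> nat \<Rightarrow> real" where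
    "D a b = (if a = 2*k \<and> b = ?p then 1 else if a = ?p \<and> b = 2*k then -1 else 0)" for a b
  define g where "g j \<sigma> = D (\<sigma> (2*j)) (\<sigma> (2*j+1)) * (\<Prod>l\<in>{..<Suc k}-{j}. H (\<sigma> (2*l)) (\<sigma> (2*l+1)))" for j \<sigma>
  have expand: "(\<Prod>i<Suc k. H (\<sigma> (2*i)) (\<sigma> (2*i+1))) = (\<Sum>j<Suc k. g j \<sigma>)"
    if \<sigma>: "\<sigma> permutes {0..<2 * Suc k}" for \<sigma>
  proof -
    obtain j where j: "j < Suc k" "\<sigma> (2*j) = ?p \<or> \<sigma> (2*j+1) = ?p"
      "\<And>i. i \<noteq> j \<Longrightarrow> \<sigma> (2*i) \<noteq> ?p \<and> \<sigma> (2*i+1) \<noteq> ?p"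
      using permutes_pair_index[OF \<sigma>, of ?p] by auto
    have D: "H (\<sigma> (2*j)) (\<sigma> (2*j+1)) = D (\<sigma> (2*j)) (\<sigma> (2*j+1))"
    proof -
      consider "\<sigma> (2*j) = ?p" "\<sigma> (2*j+1) < 2*k" | "\<sigma> (2*j) = ?p" "\<sigma> (2*j+1) = 2*k"
        | "\<sigma> (2*j+1) = ?p" "\<sigma> (2*j) < 2*k" | "\<sigma> (2*j+1) = ?p" "\<sigma> (2*j) = 2*k"
        using permutes_neq_lt[OF \<sigma> j(1)] j(2) by (metis less_Suc_eq mult_Suc_right add_2_eq_Suc)
      thus ?thesis using H0 H1 by cases (auto simp: D_def)
    qed
    have "g i \<sigma> = 0" if "i \<noteq> j" for i
      using j(3)[OF that] unfolding g_def D_def by auto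
    hence "(\<Sum>j<Suc k. g j \<sigma>) = g j \<sigma>"
      using j(1) by (subst sum.remove[of _ j]) auto
    moreover have "(\<Prod>i<Suc k. H (\<sigma> (2*i)) (\<sigma> (2*i+1))) = g j \<sigma>"
      using j(1) D unfolding g_def by (subst prod.remove[of _ j]) auto
    ultimately show ?thesis by simp
  qed
  \<comment> \<open>Exchanging pair \<open>j\<close> with the last pair is a product of two
    transpositions, hence even, so the sign factor is preserved.\<close>
  have swap_pair: "(\<Sum>\<sigma>\<in>?S. signof \<sigma> * g j \<sigma>) = (\<Sum>\<sigma>\<in>?S. signof \<sigma> * g k \<sigma>)" if j: "j < Suc k" for j
  proof (cases "j = k")
    case False
    let ?t1 = "transpose (2*j) (2*k)" and ?t2 = "transpose (Suc (2*j)) ?p"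
    define \<pi> where "\<pi> = ?t1 \<circ> ?t2"
    have t: "?t1 permutes {0..<2*Suc k}" "?t2 permutes {0..<2*Suc k}"
      using j by (auto intro!: permutes_swap_id)
    have \<pi>: "\<pi> permutes {0..<2*Suc k}"
      unfolding \<pi>_def by (rule permutes_compose[OF t(2,1)])
    have \<pi>_pair: "\<pi> (2*l) = 2 * transpose j k l" "\<pi> (2*l+1) = 2 * transpose j k l + 1" for l
    proof -
      have ne: "2*a \<noteq> Suc (2*b)" "Suc (2*b) \<noteq> 2*a" for a b :: nat by presburger+
      have "?t1 (2*l) = 2 * transpose j k l" "?t1 (Suc (2*l)) = Suc (2*l)"
        "?t2 (2*l) = 2*l" "?t2 (Suc (2*l)) = Suc (2 * transpose j k l)" for l
        using ne by (simp_all add: transpose_def)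
      thus "\<pi> (2*l) = 2 * transpose j k l" "\<pi> (2*l+1) = 2 * transpose j k l + 1"
        using ne unfolding \<pi>_def by (simp_all add: transpose_def)
    qed
    have sgn: "signof (\<sigma> \<circ> \<pi>) = (signof \<sigma> :: real)" if \<sigma>: "\<sigma> permutes {0..<2*Suc k}" for \<sigma>
    proof -
      have "\<sigma> \<circ> ?t1 permutes {0..<2*Suc k}" by (rule permutes_compose[OF t(1) \<sigma>])
      hence "signof ((\<sigma> \<circ> ?t1) \<circ> ?t2) = - (signof (\<sigma> \<circ> ?t1) :: real)"
        using False j by (intro signof_transpose_compose(2)) auto
      also have "signof (\<sigma> \<circ> ?t1) = - (signof \<sigma> :: real)"
        using False j by (intro signof_transpose_compose(2)[OF \<sigma>]) auto
      finally show ?thesis unfolding \<pi>_def by (simp only: o_assoc minus_minus)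
    qed
    have "g j (\<sigma> \<circ> \<pi>) = g k \<sigma>" for \<sigma>
    proof -
      have bij: "bij_betw (transpose j k) ({..<Suc k}-{j}) ({..<Suc k}-{k})"
        by (rule bij_betw_byWitness[where f' = "transpose j k"]) (use j in \<open>auto simp: transpose_def\<close>)
      have "(\<Prod>l\<in>{..<Suc k}-{j}. H (\<sigma> (2*transpose j k l)) (\<sigma> (2*transpose j k l+1)))
          = (\<Prod>l\<in>{..<Suc k}-{k}. H (\<sigma> (2*l)) (\<sigma> (2*l+1)))"
        by (rule prod.reindex_bij_betw[OF bij])
      thus ?thesis unfolding g_def o_apply \<pi>_pair by simp
    qed
    hence "(\<Sum>\<sigma>\<in>?S. signof (\<sigma> \<circ> \<pi>) * g j (\<sigma> \<circ> \<pi>)) = (\<Sum>\<sigma>\<in>?S. signof \<sigma> * g k \<sigma>)"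
      using sgn by (intro sum.cong) auto
    thus ?thesis using sum_permutations_compose_right[OF \<pi>, of "\<lambda>\<sigma>. signof \<sigma> * g j \<sigma>"] by simp
  qed simp
  define h where "h \<sigma> = (\<Prod>l<k. H (\<sigma> (2*l)) (\<sigma> (2*l+1)))" for \<sigma> :: "nat \<Rightarrow> nat"
  \<comment> \<open>\<open>ind\<close> selects one orientation of the last pair; the other one
    enters \<open>g k\<close> with a minus sign because of the entry -1 of \<open>H\<close>.\<close>
  define ind :: "nat \<Rightarrow> nat \<Rightarrow> real" where "ind a b = (if a = 2*k \<and> b = ?p then 1 else 0)" for a b
  have gk: "g k \<sigma> = ind (\<sigma> (2*k)) (\<sigma> ?p) * h \<sigma> - ind (\<sigma> ?p) (\<sigma> (2*k)) * h \<sigma>" for \<sigma>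
  proof -
    have "{..<Suc k} - {k} = {..<k}" by auto
    thus ?thesis unfolding g_def h_def D_def ind_def by simp
  qed
  \<comment> \<open>Swapping the last two positions reverses the last pair and leaves
    \<open>h\<close> alone. The sign change cancels the minus in \<open>gk\<close>, so both
    orientations contribute the same.\<close>
  have orient: "(\<Sum>\<sigma>\<in>?S. signof \<sigma> * (ind (\<sigma> ?p) (\<sigma> (2*k)) * h \<sigma>)) =
      - (\<Sum>\<sigma>\<in>?S. signof \<sigma> * (ind (\<sigma> (2*k)) (\<sigma> ?p) * h \<sigma>))"
  proof -
    let ?t = "transpose (2*k) ?p"
    have t: "?t permutes {0..<2*Suc k}" by (auto intro!: permutes_swap_id)
    have h: "h (\<sigma> \<circ> ?t) = h \<sigma>" for \<sigma>
      unfolding h_def by (rule prod.cong) (auto simp: transpose_def)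
    have "(\<Sum>\<sigma>\<in>?S. signof \<sigma> * (ind (\<sigma> ?p) (\<sigma> (2*k)) * h \<sigma>)) =
      (\<Sum>\<sigma>\<in>?S. signof (\<sigma> \<circ> ?t) * (ind ((\<sigma> \<circ> ?t) ?p) ((\<sigma> \<circ> ?t) (2*k)) * h (\<sigma> \<circ> ?t)))"
      by (rule sum_permutations_compose_right[OF t])
    also have "\<dots> = (\<Sum>\<sigma>\<in>?S. - (signof \<sigma> * (ind (\<sigma> (2*k)) (\<sigma> ?p) * h \<sigma>)))"
      by (rule sum.cong[OF refl]) (simp add: h signof_transpose_compose(2)[of _ "2*Suc k"])
    finally show ?thesis by (simp add: sum_negf)
  qed
  \<comment> \<open>The surviving permutations fix the last two points, which makes them the
    permutations of \<open>{0..<2*k}\<close>.\<close>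
  have fixing: "{\<sigma> \<in> ?S. \<sigma> (2*k) = 2*k \<and> \<sigma> ?p = ?p} = {\<sigma>. \<sigma> permutes {0..<2*k}}"
  proof (intro equalityI subsetI)
    fix \<sigma> assume "\<sigma> \<in> {\<sigma> \<in> ?S. \<sigma> (2*k) = 2*k \<and> \<sigma> ?p = ?p}"
    hence \<sigma>: "\<sigma> permutes {0..<2*Suc k}" "\<sigma> (2*k) = 2*k" "\<sigma> ?p = ?p" by auto
    have "{0..<2*Suc k} - {0..<2*k} = {2*k, ?p}" by auto
    hence "\<sigma> permutes {0..<2*k}" using \<sigma> by (intro permutes_superset[OF \<sigma>(1)]) auto
    thus "\<sigma> \<in> {\<sigma>. \<sigma> permutes {0..<2*k}}" by simp
  next
    fix \<sigma> assume "\<sigma> \<in> {\<sigma>. \<sigma> permutes {0..<2*k}}"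
    hence \<sigma>: "\<sigma> permutes {0..<2*k}" by simp
    have "\<sigma> permutes {0..<2*Suc k}" by (rule permutes_subset[OF \<sigma>]) auto
    thus "\<sigma> \<in> {\<sigma> \<in> ?S. \<sigma> (2*k) = 2*k \<and> \<sigma> ?p = ?p}"
      using permutes_not_in[OF \<sigma>, of "2*k"] permutes_not_in[OF \<sigma>, of ?p] by simp
  qed
  have fin: "finite ?S" by (rule finite_permutations) simp
  have "(\<Sum>\<sigma>\<in>?S. signof \<sigma> * (ind (\<sigma> (2*k)) (\<sigma> ?p) * h \<sigma>)) =
      (\<Sum>\<sigma>\<in>{\<sigma> \<in> ?S. \<sigma> (2*k) = 2*k \<and> \<sigma> ?p = ?p}. signof \<sigma> * h \<sigma>)"
    by (rule sum.mono_neutral_cong_right[OF fin]) (auto simp: ind_def)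
  also have "\<dots> = (\<Sum>\<sigma> | \<sigma> permutes {0..<2*k}. signof \<sigma> * (\<Prod>l<k. G (\<sigma> (2*l)) (\<sigma> (2*l+1))))"
    unfolding fixing
  proof (rule sum.cong[OF refl])
    fix \<sigma> assume "\<sigma> \<in> {\<sigma>. \<sigma> permutes {0..<2*k}}"
    hence "h \<sigma> = (\<Prod>l<k. G (\<sigma> (2*l)) (\<sigma> (2*l+1)))"
      unfolding h_def by (intro prod.cong refl G permutes_neq_lt) auto
    thus "signof \<sigma> * h \<sigma> = signof \<sigma> * (\<Prod>l<k. G (\<sigma> (2*l)) (\<sigma> (2*l+1)))" by simp
  qed
  finally have one: "(\<Sum>\<sigma>\<in>?S. signof \<sigma> * (ind (\<sigma> (2*k)) (\<sigma> ?p) * h \<sigma>)) = 2^k * fact k * pf_fun G k"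
    unfolding pf_fun_def by simp
  have "(\<Sum>\<sigma>\<in>?S. signof \<sigma> * (\<Prod>i<Suc k. H (\<sigma> (2*i)) (\<sigma> (2*i+1))))
      = (\<Sum>\<sigma>\<in>?S. \<Sum>j<Suc k. signof \<sigma> * g j \<sigma>)"
    by (rule sum.cong[OF refl], subst expand) (auto simp: sum_distrib_left simp del: sum.lessThan_Suc)
  also have "\<dots> = (\<Sum>j<Suc k. \<Sum>\<sigma>\<in>?S. signof \<sigma> * g j \<sigma>)" by (rule sum.swap)
  also have "\<dots> = (\<Sum>j<Suc k. \<Sum>\<sigma>\<in>?S. signof \<sigma> * g k \<sigma>)"
    by (rule sum.cong[OF refl], rule swap_pair) simp
  also have "\<dots> = real (Suc k) * (\<Sum>\<sigma>\<in>?S. signof \<sigma> * g k \<sigma>)" by simp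
  also have "(\<Sum>\<sigma>\<in>?S. signof \<sigma> * g k \<sigma>) = 2 * (2^k * fact k * pf_fun G k)"
    unfolding gk right_diff_distrib sum_subtractf orient one by simp
  finally have "(\<Sum>\<sigma>\<in>?S. signof \<sigma> * (\<Prod>i<Suc k. H (\<sigma> (2*i)) (\<sigma> (2*i+1))))
      = 2 ^ Suc k * fact (Suc k) * pf_fun G k" by (simp add: algebra_simps)
  thus ?thesis unfolding pf_fun_def[of H] by (simp del: fact_Suc power_Suc)
qed

section \<open>Principal Pfaffians\<close>

text \<open>\<open>J\<close> is 0-based. Through \<open>pick\<close>, a change of the index set
  becomes a change of its increasing enumeration, without forming a submatrix.\<close>

definition principal_pf :: "real mat \<Rightarrow> nat set \<Rightarrow> real" where
  "principal_pf A J = pf_fun (\<lambda>a b. A $$ (pick J a, pick J b)) (card J div 2)"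

lemma pf_sub_eq_principal_pf:
  assumes "A \<in> carrier_mat n n" "I \<subseteq> {1..n}" "even (card I)"
  shows "pf_sub A I = principal_pf A ((\<lambda>i. i - 1) ` I)"
proof -
  define J where "J = (\<lambda>i. i - 1) ` I"
  have inj: "inj_on (\<lambda>i. i - 1) I"
    using assms(2) by (intro inj_on_diff_nat) auto
  have J: "{a. a < n \<and> a \<in> J} = J" "card J = card I"
    using assms(2) card_image[OF inj] unfolding J_def by force+
  have "pfaffian (submatrix A J J) = pf_fun (\<lambda>a b. submatrix A J J $$ (a, b)) (card J div 2)"
    unfolding pfaffian_def pf_fun_def Let_def dim_submatrix using assms(1) J(1) by simp
  also have "\<dots> = pf_fun (\<lambda>a b. A $$ (pick J a, pick J b)) (card J div 2)"
    by (rule pf_fun_cong) (use assms(1,3) J in \<open>auto simp: submatrix_index\<close>)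
  finally show ?thesis unfolding pf_sub_def principal_pf_def J_def .
qed

text \<open>The \<open>k\<close>-th element of \<open>J\<close> is the one with exactly
  \<open>k\<close> elements of \<open>J\<close> below it, and an increasing enumeration of
  \<open>J\<close> has this property.\<close>

lemma pick_eqI:
  assumes mono: "strict_mono_on {..<card J} f" and im: "f ` {..<card J} = J" and k: "k < card J"
  shows "pick J k = f k"
proof -
  have "{a \<in> J. a < f k} = f ` {..<k}"
  proof (intro equalityI subsetI)
    fix a assume "a \<in> {a \<in> J. a < f k}"
    then obtain l where l: "l < card J" "a = f l" "f l < f k" using im by auto
    have "l < k" using l k strict_mono_on_less[OF mono, of l k] by auto
    thus "a \<in> f ` {..<k}" using l by auto
  next
    fix a assume "a \<in> f ` {..<k}"
    then obtain l where l: "l < k" "a = f l" by auto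
    hence "f l < f k" using mono k by (auto simp: strict_mono_on_def)
    thus "a \<in> {a \<in> J. a < f k}" using l im k by auto
  qed
  moreover have "inj_on f {..<k}"
    using strict_mono_on_imp_inj_on[OF mono] k by (auto intro: inj_on_subset)
  ultimately have "card {a \<in> J. a < f k} = k" by (simp add: card_image)
  moreover have "f k \<in> J" using im k by blast
  ultimately show ?thesis using pick_card_in_set[of "f k" J] by simp
qed

lemma pick_position:
  assumes "finite J" "i \<in> J"
  obtains p where "p < card J" "pick J p = i" "\<And>a. a < card J \<Longrightarrow> a \<noteq> p \<Longrightarrow> pick J a \<noteq> i"
proof -
  let ?p = "card {a \<in> J. a < i}"
  have "{a \<in> J. a < i} \<subset> J" using assms by auto
  hence lt: "?p < card J" using assms(1) by (rule psubset_card_mono[rotated])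
  have "pick J a \<noteq> i" if "a < card J" "a \<noteq> ?p" for a
    using card_pick_le[OF that(1)] that(2) by auto
  with lt pick_card_in_set[OF assms(2)] show ?thesis using that by blast
qed

text \<open>Linearity at \<open>i\<close> leaves the Pfaffian sum with \<open>i\<close> replaced by
  \<open>Suc i\<close>. It vanishes if \<open>Suc i\<close> is already in \<open>J\<close>;
  otherwise it is a principal Pfaffian with no extra sign, since no index lies strictly between
  \<open>i\<close> and \<open>Suc i\<close>.\<close>

lemma principal_pf_hop:
  assumes J: "finite J" "even (card J)"
    and off: "\<And>a b. a \<in> J \<Longrightarrow> b \<in> J \<Longrightarrow> a \<noteq> i \<Longrightarrow> b \<noteq> i \<Longrightarrow> A' $$ (a, b) = A $$ (a, b)"
    and row: "\<And>b. i \<in> J \<Longrightarrow> b \<in> J \<Longrightarrow> b \<noteq> i \<Longrightarrow> A' $$ (i, b) = A $$ (i, b) - t * A $$ (Suc i, b)"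
    and col: "\<And>a. i \<in> J \<Longrightarrow> a \<in> J \<Longrightarrow> a \<noteq> i \<Longrightarrow> A' $$ (a, i) = A $$ (a, i) - t * A $$ (a, Suc i)"
  shows "principal_pf A' J = principal_pf A J -
    (if i \<in> J \<and> Suc i \<notin> J then t * principal_pf A (insert (Suc i) (J - {i})) else 0)"
proof (cases "i \<in> J")
  case False
  hence "principal_pf A' J = principal_pf A J" unfolding principal_pf_def
    using J pick_in_set_le[of _ J] by (intro pf_fun_cong off) auto
  thus ?thesis using False by simp
next
  case True
  let ?m = "card J div 2"
  have m: "2 * ?m = card J" using J(2) by simp
  obtain p where p: "p < card J" "pick J p = i" "\<And>a. a < card J \<Longrightarrow> a \<noteq> p \<Longrightarrow> pick J a \<noteq> i"
    using pick_position[OF J(1) True] by blast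
  \<comment> \<open>The enumeration of \<open>J\<close> with the entry \<open>i\<close> overwritten
    by \<open>Suc i\<close>.\<close>
  define q where "q = (pick J)(p := Suc i)"
  let ?H = "\<lambda>a b. A $$ (q a, q b)"
  have q: "q p = Suc i" "\<And>a. a \<noteq> p \<Longrightarrow> q a = pick J a" unfolding q_def by auto
  have lin: "principal_pf A' J = principal_pf A J + (-t) * pf_fun ?H ?m"
    unfolding principal_pf_def
  proof (rule pf_fun_linear[of p], unfold m)
    show "p < card J" by fact
  qed (use p q off row col True pick_in_set_le[of _ J] in auto)
  show ?thesis
  proof (cases "Suc i \<in> J")
    case Si: True
    obtain r where r: "r < card J" "pick J r = Suc i"
      using pick_position[OF J(1) Si] by blast
    have "r \<noteq> p" using p r by auto
    \<comment> \<open>Here \<open>q\<close> takes the value \<open>Suc i\<close> at both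
      \<open>p\<close> and \<open>r\<close>, so swapping these positions changes nothing.\<close>
    moreover have "q (transpose p r a) = q a" for a
      using q r(2) \<open>r \<noteq> p\<close> by (auto simp: transpose_def)
    ultimately have "pf_fun ?H ?m = 0"
      using p(1) r(1) m by (intro pf_fun_eq_0[of p _ r]) auto
    thus ?thesis using lin Si by simp
  next
    case Si: False
    let ?K = "insert (Suc i) (J - {i})"
    have card: "card ?K = card J" using Si True J(1)
      by (metis Diff_iff card_Suc_Diff1 card_insert_disjoint finite_Diff)
    have "strict_mono_on {..<card J} q"
    proof (rule strict_mono_onI)
      fix a b assume ab: "a \<in> {..<card J}" "b \<in> {..<card J}" "a < b"
      have lt: "pick J a < pick J b" using ab by (intro pick_mono_le) auto
      have "pick J b \<noteq> Suc i" using Si pick_in_set_le[of b J] ab by auto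
      thus "q a < q b" using lt p(2) ab(3) unfolding q_def by auto
    qed
    moreover have "q ` {..<card J} = ?K"
    proof (rule card_subset_eq)
      show "q ` {..<card J} \<subseteq> ?K"
        using p pick_in_set_le[of _ J] unfolding q_def by auto
      show "card (q ` {..<card J}) = card ?K"
        using strict_mono_on_imp_inj_on[OF calculation] card by (simp add: card_image)
    qed (use J(1) in simp)
    ultimately have "pick ?K a = q a" if "a < card J" for a
      using that by (intro pick_eqI) (auto simp: card)
    hence "principal_pf A ?K = pf_fun ?H ?m"
      unfolding principal_pf_def card using m by (intro pf_fun_cong) auto
    thus ?thesis using lin Si True by simp
  qed
qed

text \<open>The two top indices are \<open>n\<close> and \<open>Suc n\<close>. By linearity at
  \<open>Suc n\<close>, the correction is a Pfaffian whose last row and column have only the entries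
  1 and -1 at the top pair, and \<open>pf_fun_unit_last\<close> removes that pair.\<close>

lemma principal_pf_top_pair:
  assumes J: "J \<subseteq> {..<Suc (Suc n)}" "even (card J)"
    and off: "\<And>a b. a \<in> J \<Longrightarrow> b \<in> J \<Longrightarrow> a \<noteq> b \<Longrightarrow> (a,b) \<noteq> (n, Suc n) \<Longrightarrow> (a,b) \<noteq> (Suc n, n) \<Longrightarrow>
      A' $$ (a, b) = A $$ (a, b)"
    and top: "A' $$ (n, Suc n) = A $$ (n, Suc n) + t" "A' $$ (Suc n, n) = A $$ (Suc n, n) - t"
  shows "principal_pf A' J = principal_pf A J +
    (if n \<in> J \<and> Suc n \<in> J then t * principal_pf A (J - {n, Suc n}) else 0)"
proof (cases "n \<in> J \<and> Suc n \<in> J")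
  case False
  have "A' $$ (pick J a, pick J b) = A $$ (pick J a, pick J b)"
    if "a < card J" "b < card J" "a \<noteq> b" for a b
  proof -
    have "pick J a \<noteq> pick J b"
      using that pick_mono_le[of a J b] pick_mono_le[of b J a] by (metis nat_neq_iff)
    thus ?thesis
      using False that pick_in_set_le[of a J] pick_in_set_le[of b J] by (intro off) auto
  qed
  hence "principal_pf A' J = principal_pf A J"
    unfolding principal_pf_def using J(2) by (intro pf_fun_cong) auto
  thus ?thesis using False by auto
next
  case True
  define K where "K = J - {n, Suc n}"
  define k where "k = card K div 2"
  have fin: "finite J" using J(1) finite_subset by blast
  have "card K = card J - card {n, Suc n}"
    unfolding K_def by (rule card_Diff_subset) (use True in auto)
  moreover have "card {n, Suc n} \<le> card J" by (rule card_mono[OF fin]) (use True in auto)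
  ultimately have cardJ: "card J = Suc (Suc (card K))" by simp
  hence cK: "card K = 2*k" using J(2) unfolding k_def by simp
  have K: "K \<subseteq> {..<n}" using J(1) unfolding K_def by (auto simp: less_Suc_eq)
  \<comment> \<open>The increasing enumeration of \<open>J\<close>: first \<open>K\<close>, then the
    two top indices at positions \<open>2*k\<close> and \<open>Suc (2*k)\<close>.\<close>
  define f where "f a = (if a < 2*k then pick K a else n + (a - 2*k))" for a
  have mono: "strict_mono_on {..<card J} f"
  proof (rule strict_mono_onI)
    fix a b assume ab: "a \<in> {..<card J}" "b \<in> {..<card J}" "a < b"
    show "f a < f b"
    proof (cases "a < 2*k")
      case True
      hence "pick K a < n" using K pick_in_set_le[of a K] cK by auto
      moreover have "b < 2*k \<Longrightarrow> pick K a < pick K b"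
        using ab cK by (intro pick_mono_le) auto
      ultimately show ?thesis using True unfolding f_def by auto
    next
      case False
      thus ?thesis using ab(3) unfolding f_def by auto
    qed
  qed
  have "f ` {..<card J} = J"
  proof (rule card_subset_eq[OF fin])
    have "f a \<in> J" if "a < card J" for a
    proof -
      have "a < 2*k \<or> a = 2*k \<or> a = Suc (2*k)" using that cK cardJ by linarith
      then consider "a < 2*k" | "a = 2*k" | "a = Suc (2*k)" by blast
      thus ?thesis
        using True pick_in_set_le[of a K] cK unfolding f_def by cases (auto simp: K_def)
    qed
    thus "f ` {..<card J} \<subseteq> J" by auto
    show "card (f ` {..<card J}) = card J"
      using strict_mono_on_imp_inj_on[OF mono] by (simp add: card_image)
  qed
  hence pick: "pick J a = f a" if "a < card J" for a using mono that by (intro pick_eqI) auto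
  let ?p = "Suc (2*k)"
  \<comment> \<open>The entries of \<open>A\<close> along \<open>f\<close>, with the last row and
    column replaced by those of the elementary skew-symmetric matrix in the last two
    positions.\<close>
  define H :: "nat \<Rightarrow> nat \<Rightarrow> real" where
    "H a b = (if a = ?p then if b = 2*k then -1 else 0
       else if b = ?p then if a = 2*k then 1 else 0 else A $$ (f a, f b))" for a b
  have m: "card J div 2 = Suc k" using cardJ cK by simp
  have fJ: "f a \<in> J" if "a < 2 * Suc k" for a
    using pick[of a] pick_in_set_le[of a J] that cardJ cK by auto
  have fp: "f ?p = Suc n" "f (2*k) = n" unfolding f_def by auto
  have f_lt: "f a < n" if "a < 2*k" for a
    using K pick_in_set_le[of a K] that cK unfolding f_def by auto
  have f_cases: "a < 2*k \<or> a = 2*k \<or> a = ?p" if "a < 2 * Suc k" for a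
    using that by (auto simp: less_Suc_eq)
  have f_neq: "f a \<noteq> f b" if "a < 2 * Suc k" "b < 2 * Suc k" "a \<noteq> b" for a b
    using strict_mono_on_imp_inj_on[OF mono] that cardJ cK by (auto dest: inj_onD)
  \<comment> \<open>The diagonal of \<open>A'\<close> is unconstrained, but it does not enter the Pfaffian.\<close>
  have diag: "pf_fun (\<lambda>a b. A' $$ (f a, f b)) (Suc k) =
      pf_fun (\<lambda>a b. if a = b then A $$ (f a, f b) else A' $$ (f a, f b)) (Suc k)"
    by (rule pf_fun_cong) simp
  have "pf_fun (\<lambda>a b. if a = b then A $$ (f a, f b) else A' $$ (f a, f b)) (Suc k) =
      pf_fun (\<lambda>a b. A $$ (f a, f b)) (Suc k) + t * pf_fun H (Suc k)"
  proof (rule pf_fun_linear[of ?p], goal_cases)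
    case (2 a b)
    hence ab: "a < Suc (2*k)" "b < Suc (2*k)" by auto
    have lt: "f a < Suc n" "f b < Suc n" using ab f_lt fp(2) by (metis less_Suc_eq)+
    have "A' $$ (f a, f b) = A $$ (f a, f b)" if "a \<noteq> b"
      using lt that 2 f_neq fJ by (intro off) auto
    thus ?case using 2 unfolding H_def by auto
  next
    case (3 b)
    have "A' $$ (Suc n, f b) = A $$ (Suc n, f b)" if "b \<noteq> 2*k"
      using f_lt[of b] f_cases[of b] that 3 fJ True by (intro off) auto
    thus ?case using 3 top fp unfolding H_def by auto
  next
    case (4 a)
    have "A' $$ (f a, Suc n) = A $$ (f a, Suc n)" if "a \<noteq> 2*k"
      using f_lt[of a] f_cases[of a] that 4 fJ True by (intro off) auto
    thus ?case using 4 top fp unfolding H_def by auto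
  qed simp
  also have "pf_fun H (Suc k) = pf_fun (\<lambda>a b. A $$ (pick K a, pick K b)) k"
    by (rule pf_fun_unit_last) (auto simp: H_def f_def)
  finally have "pf_fun (\<lambda>a b. A' $$ (f a, f b)) (Suc k) =
      pf_fun (\<lambda>a b. A $$ (f a, f b)) (Suc k) + t * principal_pf A K"
    unfolding diag unfolding principal_pf_def k_def .
  moreover have "principal_pf X J = pf_fun (\<lambda>a b. X $$ (f a, f b)) (Suc k)" for X
    unfolding principal_pf_def m by (rule pf_fun_cong) (use pick cardJ cK in auto)
  ultimately show ?thesis using True unfolding K_def by simp
qed

section \<open>Action of the generators\<close>

definition top_pair :: "nat \<Rightarrow> real \<Rightarrow> real mat" where
  "top_pair n t = mat n n (\<lambda>(r,c). if r = n-2 \<and> c = n-1 then t else if r = n-1 \<and> c = n-2 then -t else 0)"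

text \<open>The generator index \<open>i\<close> is 1-based while matrix indices are 0-based, so
  \<open>x_i\<close> with \<open>i < n\<close> involves rows and columns \<open>i-1\<close> and
  \<open>i\<close>. Every \<open>i\<close> from \<open>n\<close> upwards acts as
  \<open>x_n\<close>.\<close>

definition act :: "nat \<Rightarrow> nat \<Rightarrow> real \<Rightarrow> real mat \<Rightarrow> real mat" where
  "act n i t A = (if i < n then addcol (-t) (i-1) i (addrow (-t) (i-1) i A) else A + top_pair n t)"

text \<open>\<open>K\<close> is the configuration before the move and \<open>J\<close> the one after
  it. Sites are 0-based, so the letter \<open>i\<close> moves a particle from site \<open>i\<close>
  to site \<open>i-1\<close>.\<close>

definition hop :: "nat \<Rightarrow> nat \<Rightarrow> nat set \<Rightarrow> nat set \<Rightarrow> bool" where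
  "hop n i K J \<longleftrightarrow> (if i < n then i \<in> K \<and> i - 1 \<notin> K \<and> J = insert (i-1) (K - {i})
     else n - 2 \<notin> K \<and> n - 1 \<notin> K \<and> J = insert (n-2) (insert (n-1) K))"

text \<open>The exponent is congruent mod 2 to the one in the theorem: after the shift to 0-based
  indices the latter becomes \<open>\<Sum>J - (card J choose 2)\<close>.\<close>

definition signed_pf :: "real mat \<Rightarrow> nat set \<Rightarrow> real" where
  "signed_pf A J = (-1) ^ (\<Sum>J + (card J choose 2)) * principal_pf A J"

lemma act_carrier [simp]: "A \<in> carrier_mat n n \<Longrightarrow> act n i t A \<in> carrier_mat n n"
proof -
  assume "A \<in> carrier_mat n n"
  hence "dim_row A = n" "dim_col A = n" by auto
  thus "act n i t A \<in> carrier_mat n n"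
    unfolding act_def top_pair_def by (intro carrier_matI) simp_all
qed

lemma hop_subset_even:
  assumes "hop n i K J" "K \<subseteq> {..<n}" "even (card K)" "2 \<le> n"
  shows "J \<subseteq> {..<n}" "even (card J)"
proof -
  have fin: "finite K" using assms(2) finite_subset by blast
  show "J \<subseteq> {..<n}" using assms unfolding hop_def by (auto split: if_splits)
  show "even (card J)"
  proof (cases "i < n")
    case True
    hence "i \<in> K" "i - 1 \<notin> K" "J = insert (i-1) (K - {i})" using assms(1) unfolding hop_def by auto
    hence "card J = card K" using fin
      by (metis Diff_iff card_Suc_Diff1 card_insert_disjoint finite_Diff)
    thus ?thesis using assms(3) by simp
  next
    case False
    thus ?thesis using assms fin unfolding hop_def by (simp add: card_insert_if)
  qed
qed

text \<open>Replacing \<open>i-1\<close> by \<open>i\<close> raises the index sum by one and keeps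
  the cardinality, so the normalising sign turns the coefficient \<open>-t\<close> into
  \<open>t\<close>.\<close>

lemma signed_pf_act_shift:
  assumes A: "A \<in> carrier_mat n n" and i: "1 \<le> i" "i < n"
    and J: "J \<subseteq> {..<n}" "even (card J)"
  shows "signed_pf (act n i t A) J = signed_pf A J +
    (if i - 1 \<in> J \<and> i \<notin> J then t * signed_pf A (insert i (J - {i-1})) else 0)"
proof -
  have fin: "finite J" using J(1) finite_subset by blast
  have Si: "Suc (i - 1) = i" using i by simp
  let ?K = "insert i (J - {i-1})"
  have eq: "principal_pf (act n i t A) J = principal_pf A J -
    (if i - 1 \<in> J \<and> Suc (i - 1) \<notin> J then t * principal_pf A (insert (Suc (i-1)) (J - {i-1})) else 0)"
    by (rule principal_pf_hop[OF fin J(2)])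
      (use A i J(1) in \<open>auto simp: act_def subset_iff\<close>)
  show ?thesis
  proof (cases "i - 1 \<in> J \<and> i \<notin> J")
    case True
    have "card ?K = card J" using True fin
      by (metis Diff_iff card_Suc_Diff1 card_insert_disjoint finite_Diff)
    moreover have "\<Sum>?K = Suc (\<Sum>J)"
    proof -
      have "\<Sum>J = (i - 1) + \<Sum>(J - {i-1})" using sum.remove[OF fin, of "i-1" "\<lambda>x. x"] True by simp
      moreover have "\<Sum>?K = i + \<Sum>(J - {i-1})" using fin True by (subst sum.insert) auto
      ultimately show ?thesis using i by simp
    qed
    moreover have "principal_pf (act n i t A) J = principal_pf A J - t * principal_pf A ?K"
      using eq True unfolding Si by simp
    ultimately show ?thesis using True unfolding signed_pf_def
      by (simp add: right_diff_distrib mult.left_commute)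
  next
    case False
    thus ?thesis using eq unfolding Si signed_pf_def by auto
  qed
qed

text \<open>Removing the top pair changes the exponent by the even number
  \<open>2 * (Suc l + card ?K)\<close>, where \<open>l\<close> is \<open>n-2\<close>, so the
  coefficient \<open>t\<close> keeps its sign.\<close>

lemma signed_pf_act_top:
  assumes A: "A \<in> carrier_mat n n" and n: "2 \<le> n" and i: "\<not> i < n"
    and J: "J \<subseteq> {..<n}" "even (card J)"
  shows "signed_pf (act n i t A) J = signed_pf A J +
    (if n - 2 \<in> J \<and> n - 1 \<in> J then t * signed_pf A (J - {n-2, n-1}) else 0)"
proof -
  obtain l where l: "n = Suc (Suc l)" using n by (metis add_2_eq_Suc le_Suc_ex)
  have fin: "finite J" using J(1) finite_subset by blast
  have eq: "principal_pf (act n i t A) J = principal_pf A J +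
    (if l \<in> J \<and> Suc l \<in> J then t * principal_pf A (J - {l, Suc l}) else 0)"
    by (rule principal_pf_top_pair)
      (use A i J l in \<open>auto simp: act_def top_pair_def subset_iff\<close>)
  show ?thesis
  proof (cases "l \<in> J \<and> Suc l \<in> J")
    case True
    let ?K = "J - {l, Suc l}"
    have JK: "J = insert l (insert (Suc l) ?K)" using True by auto
    have card: "card J = Suc (Suc (card ?K))"
      by (subst JK) (use fin in \<open>simp add: card_insert_if\<close>)
    have "\<Sum>J = l + (Suc l + \<Sum>?K)"
      by (subst JK) (use fin in simp)
    moreover have "card J choose 2 = (card ?K choose 2) + 2 * card ?K + 1"
      unfolding card by (simp add: numeral_2_eq_2)
    ultimately have "\<Sum>J + (card J choose 2) = \<Sum>?K + (card ?K choose 2) + 2 * (Suc l + card ?K)"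
      by simp
    hence "(-1::real) ^ (\<Sum>J + (card J choose 2)) = (-1) ^ (\<Sum>?K + (card ?K choose 2))"
      by (simp only: power_add power_mult) simp
    thus ?thesis using eq True l unfolding signed_pf_def by (simp add: algebra_simps)
  next
    case False
    thus ?thesis using eq l unfolding signed_pf_def by auto
  qed
qed

text \<open>Both update formulas add a nonnegative multiple of another normalised Pfaffian. This is
  what allows a letter to be skipped.\<close>

lemma signed_pf_act_ge:
  assumes "A \<in> carrier_mat n n" "1 \<le> i" "2 \<le> n" "J \<subseteq> {..<n}" "even (card J)" "0 \<le> t"
    and nonneg: "\<And>J. J \<subseteq> {..<n} \<Longrightarrow> even (card J) \<Longrightarrow> 0 \<le> signed_pf A J"
  shows "signed_pf A J \<le> signed_pf (act n i t A) J"
proof -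
  have fin: "finite J" using assms(4) finite_subset by blast
  show ?thesis
  proof (cases "i < n")
    case True
    have "0 \<le> signed_pf A (insert i (J - {i-1}))" if "i - 1 \<in> J" "i \<notin> J"
    proof (rule nonneg)
      have "card (insert i (J - {i-1})) = card J" using that fin
        by (metis Diff_iff card_Suc_Diff1 card_insert_disjoint finite_Diff)
      thus "even (card (insert i (J - {i-1})))" using assms by simp
    qed (use assms True in auto)
    thus ?thesis using assms True by (subst signed_pf_act_shift) auto
  next
    case False
    have "0 \<le> signed_pf A (J - {n-2, n-1})" if "n - 2 \<in> J" "n - 1 \<in> J"
    proof (rule nonneg)
      have "card (J - {n-2,n-1}) = card J - card {n-2,n-1}"
        by (rule card_Diff_subset) (use that in auto)
      moreover have "card {n-2,n-1} = 2" using assms(3) by auto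
      ultimately show "even (card (J - {n-2, n-1}))" using assms by simp
    qed (use assms in auto)
    thus ?thesis using assms False by (subst signed_pf_act_top) auto
  qed
qed

text \<open>The update formulas read from source to target: a move determines \<open>K\<close> from
  \<open>J\<close>, and \<open>K\<close> is the set in the added term.\<close>

lemma signed_pf_act_hop:
  assumes "A \<in> carrier_mat n n" "1 \<le> i" "2 \<le> n" "K \<subseteq> {..<n}" "even (card K)" "hop n i K J"
  shows "signed_pf (act n i t A) J = signed_pf A J + t * signed_pf A K"
proof -
  note J = hop_subset_even[OF assms(6,4,5,3)]
  show ?thesis
  proof (cases "i < n")
    case True
    hence "insert i (J - {i-1}) = K" "i - 1 \<in> J" "i \<notin> J"
      using assms(2,6) unfolding hop_def by auto
    thus ?thesis using signed_pf_act_shift[OF assms(1,2) True J] by simp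
  next
    case False
    hence "J - {n-2, n-1} = K" "n - 2 \<in> J" "n - 1 \<in> J"
      using assms(6) unfolding hop_def by auto
    thus ?thesis using signed_pf_act_top[OF assms(1,3) False J] by simp
  qed
qed

section \<open>Positivity along words of generators\<close>

fun run :: "nat \<Rightarrow> real mat \<Rightarrow> (nat \<times> real) list \<Rightarrow> real mat" where
  "run n A [] = A"
| "run n A ((i,t) # ws) = run n (act n i t A) ws"

text \<open>Some subword of the word leads from the first configuration to the second: each letter
  is either skipped or used for one legal move.\<close>

inductive hops :: "nat \<Rightarrow> nat list \<Rightarrow> nat set \<Rightarrow> nat set \<Rightarrow> bool" for n where
  hops_Nil: "hops n [] J J"
| hops_skip: "hops n w K J \<Longrightarrow> hops n (i # w) K J"
| hops_Cons: "hop n i K L \<Longrightarrow> hops n w L J \<Longrightarrow> hops n (i # w) K J"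

text \<open>Induction along the word, with all normalised Pfaffians nonnegative and the one at the
  current configuration positive. A skipped letter decreases nothing; a used letter adds
  \<open>t\<close> times a positive number at the new configuration.\<close>

lemma signed_pf_run_pos:
  assumes "A \<in> carrier_mat n n" "2 \<le> n" "\<And>i t. (i, t) \<in> set ws \<Longrightarrow> 1 \<le> i \<and> 0 < t"
    and "\<And>J. J \<subseteq> {..<n} \<Longrightarrow> even (card J) \<Longrightarrow> 0 \<le> signed_pf A J"
    and "hops n (map fst ws) K J" "K \<subseteq> {..<n}" "even (card K)" "0 < signed_pf A K"
  shows "0 < signed_pf (run n A ws) J"
  using assms
proof (induction ws arbitrary: A K)
  case Nil
  thus ?case by (auto elim: hops.cases)
next
  case (Cons w ws)
  obtain i t where w: "w = (i, t)" by (cases w)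
  have it: "1 \<le> i" "0 < t" using Cons.prems(3)[of i t] w by auto
  let ?A = "act n i t A"
  have ge: "signed_pf A L \<le> signed_pf ?A L" if "L \<subseteq> {..<n}" "even (card L)" for L
    using Cons.prems it that by (intro signed_pf_act_ge) auto
  have nonneg: "0 \<le> signed_pf ?A L" if "L \<subseteq> {..<n}" "even (card L)" for L
    using ge[OF that] Cons.prems(4)[OF that] by linarith
  have step: "0 < signed_pf (run n ?A ws) J"
    if "hops n (map fst ws) L J" "L \<subseteq> {..<n}" "even (card L)" "0 < signed_pf ?A L" for L
    using that Cons.prems(1-3) nonneg by (intro Cons.IH[of ?A L]) auto
  from Cons.prems(5) have "hops n (i # map fst ws) K J" unfolding w by simp
  thus ?case unfolding w run.simps
  proof cases
    case hops_skip
    thus "0 < signed_pf (run n ?A ws) J"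
      using Cons.prems ge[of K] by (intro step) auto
  next
    case (hops_Cons L)
    note L = hop_subset_even[OF hops_Cons(1) Cons.prems(6,7,2)]
    have "signed_pf ?A L = signed_pf A L + t * signed_pf A K"
      using Cons.prems it hops_Cons(1) by (intro signed_pf_act_hop) auto
    moreover have "0 < t * signed_pf A K" using it Cons.prems by simp
    ultimately have "0 < signed_pf ?A L" using Cons.prems(4)[OF L] by linarith
    thus "0 < signed_pf (run n ?A ws) J" using hops_Cons(2) L by (intro step) auto
  qed
qed

section \<open>Reachability of even sets\<close>

lemma hops_refl: "hops n w J J"
proof (induction w)
  case Nil
  show ?case by (rule hops_Nil)
next
  case (Cons i w)
  thus ?case by (rule hops_skip)
qed

lemma hops_append: "hops n w K L \<Longrightarrow> hops n w' L J \<Longrightarrow> hops n (w @ w') K J"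
proof (induction rule: hops.induct)
  case hops_Cons
  thus ?case by (simp add: hops.hops_Cons)
qed (simp_all add: hops_skip)

text \<open>A descending run of letters carries a particle from \<open>h\<close> down to
  \<open>g\<close>, after which the remaining letters are skipped. The bound
  \<open>l \<le> Suc g\<close> ensures that the run contains the last letter used,
  \<open>Suc g\<close>.\<close>

lemma hops_slide:
  assumes "l \<le> Suc g" "g \<le> h" "h < n" "K \<inter> {g..h} = {}"
  shows "hops n (rev [l..<Suc h]) (insert h K) (insert g K)"
  using assms
proof (induction h)
  case 0
  thus ?case by (simp add: hops_refl)
next
  case (Suc h)
  show ?case
  proof (cases "g = Suc h")
    case False
    have "hop n (Suc h) (insert (Suc h) K) (insert h K)"
      using Suc.prems False unfolding hop_def by (auto simp: disjoint_iff)
    moreover have "hops n (rev [l..<Suc h]) (insert h K) (insert g K)"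
      using Suc.prems False by (intro Suc.IH) (auto simp: disjoint_iff)
    ultimately show ?thesis using Suc.prems False by (auto intro: hops_Cons)
  qed (simp add: hops_refl)
qed

lemma hops_tp_word:
  assumes n: "2 \<le> n" and J: "J \<subseteq> {..<n}" "even (card J)"
  shows "hops n (tp_word n) {} J"
proof -
  define k where "k = card J div 2"
  have card: "card J = 2*k" using J(2) unfolding k_def by simp
  have fin: "finite J" using J(1) finite_subset by blast
  have kn: "k \<le> n div 2" using card_mono[OF _ J(1)] card by simp
  let ?e = "pick J"
  note pick.simps [simp del]
  have e_lt: "?e a < n" if "a < 2*k" for a using pick_in_set_le[of a J] that card J(1) by auto
  have e_mono: "?e a < ?e b" if "a < b" "b < 2*k" for a b using that card by (intro pick_mono_le) auto
  have e_ge: "a \<le> ?e a" if "a < 2*k" for a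
  proof -
    have "card {b \<in> J. b < ?e a} \<le> card {..<?e a}" by (rule card_mono) auto
    thus ?thesis using card_pick_le[of a J] that card by simp
  qed
  define block where "block m = [n] @ rev [2*m-1..<n-1] @ rev [2*m..<n]" for m
  have main: "hops n (concat (map block [1..<m+1])) {} (?e ` {..<2*m})" if "m \<le> k" for m
    using that
  proof (induction m)
    case 0
    thus ?case by (simp add: hops_Nil)
  next
    case (Suc m)
    define K where "K = ?e ` {..<2*m}"
    define a where "a = ?e (2*m)"
    define b where "b = ?e (Suc (2*m))"
    have ab: "a < b" "b < n" using Suc.prems unfolding a_def b_def by (auto intro: e_mono e_lt)
    have K_lt: "x < a" if "x \<in> K" for x using that e_mono Suc.prems unfolding K_def a_def by auto
    \<comment> \<open>The two runs of this round end with the letters \<open>2*m+1\<close> and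
      \<open>2*m+2\<close>; these lower bounds say that they descend far enough to reach
      \<open>a\<close> and \<open>b\<close>.\<close>
    have am: "2*m \<le> a" "Suc (2*m) \<le> b" unfolding a_def b_def using Suc.prems by (auto intro: e_ge)
    \<comment> \<open>The sites filled so far lie below \<open>a < b < n\<close>, so the top two
      sites are free.\<close>
    have "n - 2 \<notin> K" "n - 1 \<notin> K" using K_lt[of "n-2"] K_lt[of "n-1"] ab by auto
    hence "hop n n K (insert (n-2) (insert (n-1) K))" unfolding hop_def by simp
    \<comment> \<open>The lower particle of the new pair moves first, which clears the way for the
      upper one.\<close>
    moreover have "hops n (rev [2 * Suc m - 1..<Suc (n-2)]) (insert (n-2) (insert (n-1) K)) (insert a (insert (n-1) K))"
    proof (rule hops_slide)
      show "insert (n-1) K \<inter> {a..n-2} = {}" using K_lt ab by fastforce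
    qed (use am ab n in auto)
    moreover have "hops n (rev [2 * Suc m..<Suc (n-1)]) (insert (n-1) (insert a K)) (insert b (insert a K))"
    proof (rule hops_slide)
      show "insert a K \<inter> {b..n-1} = {}" using K_lt ab by fastforce
    qed (use am ab n in auto)
    moreover have "Suc (n-2) = n-1" "Suc (n-1) = n" using n by auto
    ultimately have "hops n (block (Suc m)) K (insert b (insert a K))"
      unfolding block_def append_Cons append_Nil
      by (metis hops_Cons hops_append insert_commute)
    moreover have "insert b (insert a K) = ?e ` {..<2 * Suc m}"
      unfolding a_def b_def K_def by (auto simp: lessThan_Suc)
    ultimately have "hops n (concat (map block [1..<m+1]) @ block (Suc m)) {} (?e ` {..<2 * Suc m})"
      using Suc by (intro hops_append[OF Suc.IH]) (auto simp: K_def)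
    thus ?case by simp
  qed
  have "?e ` {..<2*k} = J"
  proof (rule card_subset_eq[OF fin])
    show "?e ` {..<2*k} \<subseteq> J" using pick_in_set_le[of _ J] card by auto
    have "inj_on ?e {..<2*k}" by (rule strict_mono_on_imp_inj_on) (auto simp: strict_mono_on_def e_mono)
    thus "card (?e ` {..<2*k}) = card J" using card by (simp add: card_image)
  qed
  hence "hops n (concat (map block [1..<k+1])) {} J" using main[of k] by simp
  \<comment> \<open>All rounds after the \<open>k\<close>-th are skipped entirely.\<close>
  hence "hops n (concat (map block [1..<k+1]) @ concat (map block [k+1..<n div 2 + 1])) {} J"
    by (rule hops_append) (rule hops_refl)
  moreover have "[1..<n div 2 + 1] = [1..<k+1] @ [k+1..<n div 2 + 1]"
    using kn upt_add_eq_append[of 1 "k+1" "n div 2 - k"] by simp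
  ultimately show ?thesis unfolding tp_word_def block_def by simp
qed

lemma set_tp_word: "i \<in> set (tp_word n) \<Longrightarrow> 1 \<le> i \<and> i \<le> n"
proof -
  assume "i \<in> set (tp_word n)"
  then obtain m where "m \<in> {1..<n div 2 + 1}" "i \<in> set ([n] @ rev [2*m-1..<n-1] @ rev [2*m..<n])"
    unfolding tp_word_def set_concat set_map set_upt by blast
  thus "1 \<le> i \<and> i \<le> n" by auto
qed

text \<open>The initial values: the identity product corresponds to the zero matrix, and only the
  empty configuration is populated.\<close>

lemma signed_pf_zero:
  assumes "J \<subseteq> {..<n}" "even (card J)"
  shows "signed_pf (0\<^sub>m n n) J = (if J = {} then 1 else 0)"
proof (cases "J = {}")
  case True
  thus ?thesis unfolding signed_pf_def principal_pf_def pf_fun_def by (simp add: numeral_2_eq_2)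
next
  case False
  have fin: "finite J" using assms(1) finite_subset by blast
  hence "0 < card J div 2" using False assms(2) by (metis card_0_eq dvd_div_eq_0_iff gr0I)
  moreover have "0\<^sub>m n n $$ (pick J a, pick J b) = (0::real)" if "a < card J" "b < card J" for a b
    using that assms(1) pick_in_set_le[of _ J] by (simp add: subset_iff)
  hence "principal_pf (0\<^sub>m n n) J = pf_fun (\<lambda>_ _. 0) (card J div 2)"
    unfolding principal_pf_def using assms(2) by (intro pf_fun_cong) auto
  ultimately show ?thesis using False unfolding signed_pf_def pf_fun_def by (simp add: power_0_left)
qed

section \<open>Generator products\<close>

text \<open>The paper's \<open>A = U\<^sup>-\<^sup>1 R\<close> is recorded as \<open>R = U A\<close>; the last \<open>n\<close> rows \<open>[X | Y]\<close> are irrelevant.\<close>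

definition tracks :: "nat \<Rightarrow> real mat \<Rightarrow> real mat \<Rightarrow> bool" where
  "tracks n P A \<longleftrightarrow> A \<in> carrier_mat n n \<and>
     (\<exists>U V X Y. U \<in> carrier_mat n n \<and> V \<in> carrier_mat n n \<and> X \<in> carrier_mat n n \<and> Y \<in> carrier_mat n n \<and>
        U * V = 1\<^sub>m n \<and> V * U = 1\<^sub>m n \<and> P = four_block_mat U (U * A) X Y)"

lemma tracksI:
  assumes "A \<in> carrier_mat n n" "U \<in> carrier_mat n n" "V \<in> carrier_mat n n"
    "X \<in> carrier_mat n n" "Y \<in> carrier_mat n n" "U * V = 1\<^sub>m n" "V * U = 1\<^sub>m n"
    "P = four_block_mat U (U * A) X Y"
  shows "tracks n P A"
  unfolding tracks_def using assms by blast

lemma tracks_carrier: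
  assumes "tracks n P A"
  shows "P \<in> carrier_mat (2*n) (2*n)"
proof -
  obtain U X Y where "U \<in> carrier_mat n n" "Y \<in> carrier_mat n n" "P = four_block_mat U (U * A) X Y"
    using assms unfolding tracks_def by blast
  thus ?thesis using four_block_carrier_mat[of U n n Y n n] by (simp add: mult_2)
qed

lemma eq_four_block_matI:
  assumes "M \<in> carrier_mat (n + m) (n + m)"
    and "A \<in> carrier_mat n n" "B \<in> carrier_mat n m" "C \<in> carrier_mat m n" "D \<in> carrier_mat m m"
    and "\<And>r c. r < n \<Longrightarrow> c < n \<Longrightarrow> M $$ (r, c) = A $$ (r, c)"
    and "\<And>r c. r < n \<Longrightarrow> c < m \<Longrightarrow> M $$ (r, n + c) = B $$ (r, c)"
    and "\<And>r c. r < m \<Longrightarrow> c < n \<Longrightarrow> M $$ (n + r, c) = C $$ (r, c)"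
    and "\<And>r c. r < m \<Longrightarrow> c < m \<Longrightarrow> M $$ (n + r, n + c) = D $$ (r, c)"
  shows "M = four_block_mat A B C D"
proof (rule eq_matI)
  fix r c assume "r < dim_row (four_block_mat A B C D)" "c < dim_col (four_block_mat A B C D)"
  hence rc: "r < n + m" "c < n + m" using assms by auto
  show "M $$ (r, c) = four_block_mat A B C D $$ (r, c)"
  proof (cases "r < n"; cases "c < n")
    assume "r < n" "\<not> c < n"
    thus ?thesis using assms(1-5) rc assms(7)[of r "c - n"] by simp
  next
    assume "\<not> r < n" "c < n"
    thus ?thesis using assms(1-5) rc assms(8)[of "r - n" c] by simp
  next
    assume "\<not> r < n" "\<not> c < n"
    thus ?thesis using assms(1-5) rc assms(9)[of "r - n" "c - n"] by simp
  qed (use assms(1-6) rc in simp)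
qed (use assms(1-5) in auto)

lemma xgen_carrier [simp]: "xgen n i t \<in> carrier_mat (2*n) (2*n)"
  unfolding xgen_def by simp

text \<open>The lower right block is the inverse transpose of the upper left one, which is why
  \<open>A\<close> gets transformed by a congruence.\<close>

lemma xgen_shift:
  assumes "1 \<le> i" "i < n"
  shows "xgen n i t = four_block_mat (addrow_mat n t (i-1) i) (0\<^sub>m n n) (0\<^sub>m n n) (addrow_mat n (-t) i (i-1))"
proof -
  obtain k where k: "i = Suc k" using assms(1) by (cases i) auto
  show ?thesis unfolding k
  proof (rule eq_four_block_matI)
    show "xgen n (Suc k) t \<in> carrier_mat (n + n) (n + n)"
      by (simp add: xgen_def flip: mult_2)
  qed (use assms k in \<open>simp_all add: xgen_def\<close>)
qed

lemma xgen_top: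
  assumes "2 \<le> n" "\<not> i < n"
  shows "xgen n i t = four_block_mat (1\<^sub>m n) (top_pair n t) (0\<^sub>m n n) (1\<^sub>m n)"
proof -
  obtain k where k: "n = Suc (Suc k)" using assms(1) by (metis add_2_eq_Suc le_Suc_ex)
  show ?thesis
  proof (rule eq_four_block_matI)
    show "xgen n i t \<in> carrier_mat (n + n) (n + n)"
      by (simp add: xgen_def flip: mult_2)
  qed (use assms k in \<open>simp_all add: xgen_def top_pair_def\<close>)
qed

text \<open>For \<open>i < n\<close> the top rows become \<open>[U G | U A H]\<close>, and inserting
  \<open>G * G' = 1\<close> factors the right block as \<open>(U G) (G' A H)\<close>. For
  \<open>x_n\<close> they become \<open>[U | U D + U A]\<close>, which is
  \<open>[U | U (A + D)]\<close>.\<close>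

lemma tracks_mult_xgen:
  assumes T: "tracks n P A" and n: "2 \<le> n" and i: "1 \<le> i"
  shows "tracks n (P * xgen n i t) (act n i t A)"
proof -
  obtain U V X Y where A: "A \<in> carrier_mat n n" and
    C: "U \<in> carrier_mat n n" "V \<in> carrier_mat n n" "X \<in> carrier_mat n n" "Y \<in> carrier_mat n n"
    and UV: "U * V = 1\<^sub>m n" "V * U = 1\<^sub>m n" and P: "P = four_block_mat U (U * A) X Y"
    using T unfolding tracks_def by blast
  have UA: "U * A \<in> carrier_mat n n" using A C by simp
  show ?thesis
  proof (cases "i < n")
    case True
    define G where "G = addrow_mat n t (i-1) i"
    define G' where "G' = addrow_mat n (-t) (i-1) i"
    define H where "H = addrow_mat n (-t) i (i-1)"
    have CG: "G \<in> carrier_mat n n" "G' \<in> carrier_mat n n" "H \<in> carrier_mat n n"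
      unfolding G_def G'_def H_def by simp_all
    have GG: "G * G' = 1\<^sub>m n" "G' * G = 1\<^sub>m n"
      using addrow_mat_inv[of "i-1" n i t] addrow_mat_inv[of "i-1" n i "-t"] True i
      unfolding G_def G'_def by auto
    have act: "act n i t A = G' * A * H"
    proof -
      have row: "addrow (-t) (i-1) i A = G' * A"
        unfolding G'_def by (rule addrow_mat[OF A True])
      have "addcol (-t) (i-1) i (G' * A) = G' * A * H"
        unfolding H_def by (rule addcol_mat) (use A CG True in auto)
      thus ?thesis using True row unfolding act_def by simp
    qed
    have x: "xgen n i t = four_block_mat G (0\<^sub>m n n) (0\<^sub>m n n) H"
      unfolding G_def H_def by (rule xgen_shift[OF i True])
    have "P * xgen n i t = four_block_mat (U * G + U * A * 0\<^sub>m n n) (U * 0\<^sub>m n n + U * A * H)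
        (X * G + Y * 0\<^sub>m n n) (X * 0\<^sub>m n n + Y * H)"
      unfolding P x by (rule mult_four_block_mat) (use C UA CG in auto)
    also have "U * G + U * A * 0\<^sub>m n n = U * G"
      using C CG by (simp add: right_mult_zero_mat[OF UA])
    also have "U * 0\<^sub>m n n + U * A * H = U * A * H"
      using mult_carrier_mat[OF UA CG(3)] by (simp add: right_mult_zero_mat[OF C(1)])
    also have "U * A * H = U * G * (G' * A * H)"
    proof -
      have "U * G * (G' * A * H) = U * (G * G' * (A * H))"
        using A C CG by (simp add: assoc_mult_mat[of _ n n _ n _ n])
      also have "\<dots> = U * A * H"
        using A C CG by (simp add: GG assoc_mult_mat[of _ n n _ n _ n])
      finally show ?thesis ..
    qed
    finally have "P * xgen n i t = four_block_mat (U * G) (U * G * act n i t A)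
        (X * G + Y * 0\<^sub>m n n) (X * 0\<^sub>m n n + Y * H)" unfolding act .
    moreover have "U * G * (G' * V) = 1\<^sub>m n"
    proof -
      have "U * G * (G' * V) = U * (G * G' * V)"
        using C CG by (simp add: assoc_mult_mat[of _ n n _ n _ n])
      thus ?thesis using C GG UV by simp
    qed
    moreover have "G' * V * (U * G) = 1\<^sub>m n"
    proof -
      have "G' * V * (U * G) = G' * (V * U * G)"
        using C CG by (simp add: assoc_mult_mat[of _ n n _ n _ n])
      thus ?thesis using CG GG UV by simp
    qed
    ultimately show ?thesis
      by (intro tracksI[where U = "U * G" and V = "G' * V"]) (use A C CG in auto)
  next
    case False
    define D where "D = top_pair n t"
    have D: "D \<in> carrier_mat n n" unfolding D_def top_pair_def by simp
    have x: "xgen n i t = four_block_mat (1\<^sub>m n) D (0\<^sub>m n n) (1\<^sub>m n)"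
      unfolding D_def by (rule xgen_top[OF n False])
    have "P * xgen n i t = four_block_mat (U * 1\<^sub>m n + U * A * 0\<^sub>m n n) (U * D + U * A * 1\<^sub>m n)
        (X * 1\<^sub>m n + Y * 0\<^sub>m n n) (X * D + Y * 1\<^sub>m n)"
      unfolding P x
      by (rule mult_four_block_mat[OF C(1) UA C(3,4) one_carrier_mat D zero_carrier_mat one_carrier_mat])
    also have "U * 1\<^sub>m n + U * A * 0\<^sub>m n n = U"
      using C by (simp add: right_mult_zero_mat[OF UA])
    also have "U * D + U * A * 1\<^sub>m n = U * act n i t A"
    proof -
      have "U * D + U * A * 1\<^sub>m n = U * A + U * D"
        using mult_carrier_mat[OF C(1) D]
        by (simp only: right_mult_one_mat[OF UA] comm_add_mat[OF UA])
      also have "\<dots> = U * (A + D)" using A C D by (simp add: mult_add_distrib_mat[of _ n n])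
      finally show ?thesis using False unfolding act_def D_def by simp
    qed
    finally show ?thesis
      by (intro tracksI[where U = U and V = V]) (use A C D UV in auto)
  qed
qed

text \<open>The arbitrary prefix \<open>P\<close> makes the induction work: associativity moves one
  generator at a time from the right-nested product into \<open>P\<close>.\<close>

lemma tracks_foldr:
  assumes "tracks n P A" "2 \<le> n" "\<And>i t. (i, t) \<in> set ws \<Longrightarrow> 1 \<le> i"
  shows "tracks n (P * foldr (\<lambda>(i, t) M. xgen n i t * M) ws (1\<^sub>m (2*n))) (run n A ws)"
  using assms
proof (induction ws arbitrary: P A)
  case Nil
  thus ?case using tracks_carrier[OF Nil(1)] by simp
next
  case (Cons w ws)
  obtain i t where w: "w = (i, t)" by (cases w)
  let ?M = "foldr (\<lambda>(i, t) M. xgen n i t * M) ws (1\<^sub>m (2*n))"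
  note P = tracks_carrier[OF Cons.prems(1)]
  have M: "?M \<in> carrier_mat (2*n) (2*n)"
    by (induction ws) (auto simp: split_beta intro!: mult_carrier_mat[of _ _ "2*n"])
  have "tracks n (P * xgen n i t * ?M) (run n (act n i t A) ws)"
    using Cons.prems w by (intro Cons.IH tracks_mult_xgen) auto
  thus ?case using assoc_mult_mat[OF P xgen_carrier M] w by simp
qed

lemma A_of_eq_run:
  assumes "2 \<le> n"
  shows "A_of n t = run n (0\<^sub>m n n) (map (\<lambda>k. (tp_word n ! k, t k)) [0..<length (tp_word n)])"
    (is "_ = ?A")
proof -
  let ?ws = "map (\<lambda>k. (tp_word n ! k, t k)) [0..<length (tp_word n)]"
  have one: "1\<^sub>m (2*n) = four_block_mat (1\<^sub>m n) (0\<^sub>m n n) (0\<^sub>m n n) (1\<^sub>m n :: real mat)"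
    by (rule eq_matI) auto
  have "tracks n (1\<^sub>m (2*n)) (0\<^sub>m n n)"
    unfolding one by (rule tracksI[of _ n "1\<^sub>m n" "1\<^sub>m n" "0\<^sub>m n n" "1\<^sub>m n"]) auto
  hence "tracks n (1\<^sub>m (2*n) * foldr (\<lambda>(i, t) M. xgen n i t * M) ?ws (1\<^sub>m (2*n))) ?A"
    using assms set_tp_word[OF nth_mem] by (intro tracks_foldr) auto
  moreover have "foldr (\<lambda>(i, t) M. xgen n i t * M) ?ws (1\<^sub>m (2*n)) = tp_prod n t"
    unfolding tp_prod_def by (simp add: foldr_map comp_def)
  moreover have "tp_prod n t \<in> carrier_mat (2*n) (2*n)"
  proof -
    have "foldr (\<lambda>k M. xgen n (tp_word n ! k) (t k) * M) ks (1\<^sub>m (2*n)) \<in> carrier_mat (2*n) (2*n)" for ks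
      by (induction ks) (auto intro!: mult_carrier_mat[of _ _ "2*n"])
    thus ?thesis unfolding tp_prod_def .
  qed
  ultimately have "tracks n (tp_prod n t) ?A" by simp
  then obtain U V X Y where A: "?A \<in> carrier_mat n n" and
    C: "U \<in> carrier_mat n n" "V \<in> carrier_mat n n" "X \<in> carrier_mat n n" "Y \<in> carrier_mat n n"
    and UV: "U * V = 1\<^sub>m n" "V * U = 1\<^sub>m n" and P: "tp_prod n t = four_block_mat U (U * ?A) X Y"
    unfolding tracks_def by blast
  have U: "U_part n t = U" unfolding U_part_def P by (rule eq_matI) (use C A in auto)
  have R: "R_part n t = U * ?A" unfolding R_part_def P by (rule eq_matI) (use C A in auto)
  define B where "B = mat_inv n U"
  \<comment> \<open>\<open>V\<close> witnesses that an inverse exists, so the choice in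
    \<open>mat_inv\<close> yields one, and \<open>B * U = 1\<close> then cancels
    \<open>U\<close>.\<close>
  have "B \<in> carrier_mat n n \<and> U * B = 1\<^sub>m n \<and> B * U = 1\<^sub>m n"
    unfolding B_def mat_inv_def by (rule someI[of _ V]) (use C UV in auto)
  hence B: "B \<in> carrier_mat n n" "B * U = 1\<^sub>m n" by auto
  have "A_of n t = B * (U * ?A)" unfolding A_of_def U R B_def ..
  also have "\<dots> = B * U * ?A" by (rule assoc_mult_mat[symmetric]) (use B C A in auto)
  also have "\<dots> = ?A" using B A by simp
  finally show ?thesis .
qed

theorem theorem1p5:
  fixes n :: nat and A :: "real mat" and I :: "nat set"
  assumes "n \<ge> 2"
    and "A \<in> SS_pos n"
    and "I \<subseteq> {1..n}"
    and "even (card I)"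
  shows "sgn (pf_sub A I) = (-1) ^ ((\<Sum>i\<in>I. i) - ((card I + 1) choose 2))
         \<and> pf_sub A I \<noteq> 0"
proof -
  obtain t where t: "A = A_of n t" "\<And>k. k < length (tp_word n) \<Longrightarrow> 0 < t k"
    using assms(2) unfolding SS_pos_def by blast
  let ?ws = "map (\<lambda>k. (tp_word n ! k, t k)) [0..<length (tp_word n)]"
  have A: "A = run n (0\<^sub>m n n) ?ws" using t(1) A_of_eq_run[OF assms(1)] by simp
  have "run n B ws \<in> carrier_mat n n" if "B \<in> carrier_mat n n" for B ws
    using that by (induction n B ws rule: run.induct) auto
  hence carrier: "A \<in> carrier_mat n n" unfolding A by simp
  define J where "J = (\<lambda>i. i - 1) ` I"
  have inj: "inj_on (\<lambda>i. i - 1) I" using assms(3) by (intro inj_on_diff_nat) auto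
  have J: "J \<subseteq> {..<n}" "card J = card I"
    using assms(3) card_image[OF inj] unfolding J_def by force+
  have fst: "map fst ?ws = tp_word n" by (simp add: comp_def map_nth)
  \<comment> \<open>The run starts at the zero matrix and the empty configuration, whose normalised
    Pfaffian is 1.\<close>
  have pos: "0 < signed_pf A J"
    unfolding A
  proof (rule signed_pf_run_pos)
    show "hops n (map fst ?ws) {} J"
      unfolding fst using hops_tp_word[OF assms(1) J(1)] J(2) assms(4) by simp
  qed (use assms(1) t(2) set_tp_word[OF nth_mem] in \<open>auto simp: signed_pf_zero\<close>)
  let ?s = "\<Sum>J + (card J choose 2)"
  have sum: "(\<Sum>i\<in>I. i) = \<Sum>J + card J"
  proof -
    have "(\<Sum>i\<in>I. i) = (\<Sum>i\<in>I. (i - 1) + 1)" by (rule sum.cong) (use assms(3) in auto)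
    also have "\<dots> = (\<Sum>i\<in>I. i - 1) + card I" by (simp only: sum.distrib) simp
    also have "(\<Sum>i\<in>I. i - 1) = \<Sum>J" unfolding J_def using sum.reindex[OF inj, of "\<lambda>x. x"] by (simp add: comp_def)
    finally show ?thesis using J(2) by simp
  qed
  have choose: "(card I + 1) choose 2 = card J + (card J choose 2)"
    using J(2) by (simp add: numeral_2_eq_2)
  \<comment> \<open>Distinct naturals sum to at least 0 + 1 + ... + (\<open>card J\<close> - 1).
    Hence the natural-number subtraction in the exponent is exact, and the two exponents differ by
    an even number.\<close>
  have "card J choose 2 \<le> \<Sum>J"
    using card_sum_le_nat_sum[of J] by (simp add: Sum_Ico_nat choose_two)
  hence "?s = ((\<Sum>i\<in>I. i) - ((card I + 1) choose 2)) + 2 * (card J choose 2)"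
    unfolding sum choose by simp
  hence sign: "(-1::real) ^ ?s = (-1) ^ ((\<Sum>i\<in>I. i) - ((card I + 1) choose 2))"
    by (simp only: power_add power_mult) simp
  have "pf_sub A I = principal_pf A J"
    unfolding J_def by (rule pf_sub_eq_principal_pf[OF carrier assms(3,4)])
  also have "\<dots> = (-1) ^ ?s * signed_pf A J"
    unfolding signed_pf_def by (simp flip: mult.assoc power_add)
  finally have pf: "pf_sub A I = (-1) ^ ?s * signed_pf A J" .
  have "sgn ((-1::real) ^ ?s) = (-1) ^ ?s" by (cases "even ?s") auto
  hence "sgn (pf_sub A I) = (-1) ^ ?s * sgn (signed_pf A J)"
    unfolding pf sgn_mult by (simp only:)
  thus ?thesis using pos pf unfolding sign by simp
qed

end
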